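(* Let $Y$ be an LCTV space and let $f\colon Y\to\mathbb R$ and $g_i\colon Y\to\mathbb R$, $i=1,\dots,m$, be convex and continuous functions. Assume the Slater constraint qualification: there exists $y_0\in Y$ such that $g_i(y_0)<0$ for all $i=1,\dots,m$. Then $$\inf\{f(y)\mid y\in Y,\ g_i(y)\le0\text{ for }i=1,\dots,m\}=\sup_{\lambda\in\mathbb R^m,\ \lambda\ge0}\widehat{\mathcal L}(\lambda),$$ where $\widehat{\mathcal L}(\lambda):=\inf_{y\in Y}\big\{f(y)+\sum_{i=1}^m\lambda_ig_i(y)\big\}$.
   Context: LCTV space means real locally convex Hausdorff topological vector space. $\lambda\ge0$ means $\lambda_i\ge0$ for all $i$. Both sides are understood in $\overline{\mathbb R}=\mathbb R\cup\{-\infty\}\cup\{\infty\}$ (the common value may be $-\infty$). *)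

theory Defs
  imports "HOL-Analysis.Analysis"
begin

text \<open>
  Real locally convex Hausdorff topological vector spaces. Joint continuity of scalar
  multiplication is stated at each point \<open>(a, x)\<close>, in the style of the library's
  \<^class>\<open>topological_monoid_add\<close>. Convexity is unfolded in the class
  axiom because \<^const>\<open>convex\<close> cannot be used inside a class specification.
\<close>

class lctv_space = real_vector + topological_ab_group_add + t2_space +
  assumes tendsto_scaleR_nhds_prod:
    "((\<lambda>p. fst p *\<^sub>R snd p) \<longlongrightarrow> a *\<^sub>R x) (nhds (a::real) \<times>\<^sub>F nhds x)"
  and locally_convex_0:
    "open U \<Longrightarrow> 0 \<in> U \<Longrightarrow> \<exists>V. open V \<and>
       (\<forall>x\<in>V. \<forall>y\<in>V. \<forall>u\<ge>0. \<forall>v\<ge>0. u + v = 1 \<longrightarrow> u *\<^sub>R x + v *\<^sub>R y \<in> V) \<and> 0 \<in> V \<and> V \<subseteq> U"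

lemma locally_convex_0_convex:
  fixes U :: "'a::lctv_space set"
  assumes "open U" "0 \<in> U"
  shows "\<exists>V. open V \<and> convex V \<and> 0 \<in> V \<and> V \<subseteq> U"
  unfolding convex_def using assms by (rule locally_convex_0)

lemma real_normed_vector_is_lctv_space [Pure.intro]:
  "OFCLASS('a :: real_normed_vector, lctv_space_class)"
proof
  fix a :: real and x :: 'a
  show "((\<lambda>p. fst p *\<^sub>R snd p) \<longlongrightarrow> a *\<^sub>R x) (nhds a \<times>\<^sub>F nhds x)"
    by (intro tendsto_scaleR filterlim_fst filterlim_snd)
next
  fix U :: "'a set"
  assume "open U" "0 \<in> U"
  then obtain e where "e > 0" "ball 0 e \<subseteq> U"
    by (auto simp: open_contains_ball)
  then have "\<exists>V. open V \<and> convex V \<and> 0 \<in> V \<and> V \<subseteq> U"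
    by (intro exI[of _ "ball 0 e"]) auto
  then show "\<exists>V. open V \<and>
      (\<forall>x\<in>V. \<forall>y\<in>V. \<forall>u\<ge>0. \<forall>v\<ge>0. u + v = 1 \<longrightarrow> u *\<^sub>R x + v *\<^sub>R y \<in> V) \<and> 0 \<in> V \<and> V \<subseteq> U"
    unfolding convex_def .
qed

instance real :: lctv_space ..

text \<open>
  The Lagrangian dual function. It is extended-real-valued since the infimum may be \<open>-\<infinity>\<close>.
  Vectors in \<open>\<real>\<^sup>m\<close> are encoded as extensional functions on \<open>{1..m}\<close>.
\<close>

definition lagrange_dual ::
    "nat \<Rightarrow> ('a \<Rightarrow> real) \<Rightarrow> (nat \<Rightarrow> 'a \<Rightarrow> real) \<Rightarrow> (nat \<Rightarrow> real) \<Rightarrow> ereal" where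
  "lagrange_dual m f g l = (INF y. ereal (f y + (\<Sum>i=1..m. l i * g i y)))"

end

theory Submission
  imports Defs
begin

text \<open>
  Weak duality is the remark that \<open>\<lambda>\<^sub>i g\<^sub>i(y) \<le> 0\<close> at every feasible point. For the converse,
  let \<open>p\<close> be the infimum on the left. It is below \<open>\<infinity>\<close> since the Slater point is feasible, and
  \<open>p = -\<infinity>\<close> leaves nothing to prove; for real \<open>p\<close> it suffices to find \<open>\<lambda> \<ge> 0\<close> with
  \<open>f + \<Sum>\<lambda>\<^sub>i g\<^sub>i \<ge> p\<close> everywhere. Instead of separating convex sets in \<open>\<real>\<^sup>m \<times> \<real>\<close>, the proof
  removes the constraints one at a time. Those still imposed when one is removed only shrink the convex
  domain, so each step is a problem with a single constraint \<open>g \<le> 0\<close> over a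
  convex set (\<open>lagrange_multiplier_single\<close>); there the multiplier is a number that separates two
  sets of reals, the set of lower bounds on it coming from points with \<open>g > 0\<close> and the set of
  upper bounds coming from points with \<open>g < 0\<close>. The Slater point satisfies all constraints
  strictly, hence it stays available in each of the smaller domains
  (\<open>lagrange_multipliers_finite\<close>).
\<close>

text \<open>
  The inequality at the crossing of the level \<open>g = 0\<close>: on the segment from \<open>y\<close> to \<open>z\<close>, the affine
  interpolation of \<open>g\<close> vanishes at a point which is feasible because \<open>g\<close> is convex, and there the
  bound \<open>p \<le> F\<close> is available. Solved for a multiplier, it says that the lower bound
  \<open>(p - F y) / g y\<close> does not exceed the upper bound \<open>(F z - p) / (- g z)\<close>.
\<close>

lemma convex_crossing_bound:
  fixes F g :: "'a::real_vector \<Rightarrow> real"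
  assumes F: "convex_on S F" and g: "convex_on S g"
    and bound: "\<And>w. w \<in> S \<Longrightarrow> g w \<le> 0 \<Longrightarrow> p \<le> F w"
    and y: "y \<in> S" "0 < g y" and z: "z \<in> S" "g z < 0"
  shows "(p - F y) / g y \<le> (F z - p) / (- g z)"
proof -
  define d where "d = g y - g z"
  have d: "d > 0" using y z by (simp add: d_def)
  define s t where "s = - g z / d" and "t = g y / d"
  have st: "0 \<le> s" "0 \<le> t"
    using y z d by (simp_all add: s_def t_def divide_le_0_iff)
  have "s + t = (g y - g z) / d"
    by (simp add: s_def t_def diff_divide_distrib)
  then have st1: "s + t = 1" using d by (simp add: d_def)
  have "convex S" using F by (simp add: convex_on_def)
  then have w: "s *\<^sub>R y + t *\<^sub>R z \<in> S"
    using y z st st1 by (auto simp: convex_def)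
  have "g (s *\<^sub>R y + t *\<^sub>R z) \<le> s * g y + t * g z"
    using g y z st st1 by (simp add: convex_on_def)
  also have "\<dots> = 0"
    using d by (simp add: s_def t_def field_simps)
  finally have "p \<le> F (s *\<^sub>R y + t *\<^sub>R z)"
    using bound w by blast
  also have "\<dots> \<le> s * F y + t * F z"
    using F y z st st1 by (simp add: convex_on_def)
  finally have "p * d \<le> (s * F y + t * F z) * d"
    using d by (simp add: mult_right_mono)
  also have "\<dots> = - g z * F y + g y * F z"
    using d by (simp add: s_def t_def field_simps)
  finally have "(p - F y) * (- g z) \<le> (F z - p) * g y"
    by (simp add: d_def algebra_simps)
  moreover have "0 < - g z" using z by simp
  ultimately show ?thesis
    using y by (simp only: pos_divide_le_eq times_divide_eq_left pos_le_divide_eq)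
qed

text \<open>
  The condition \<open>p \<le> F y + l * g y\<close> bounds \<open>l\<close> from below where \<open>g y > 0\<close>, from above where
  \<open>g y < 0\<close>, and holds for every \<open>l\<close> where \<open>g y = 0\<close>. The upper bounds are at least the lower ones by
  \<open>convex_crossing_bound\<close>, and they are nonnegative because \<open>p \<le> F\<close> at feasible points. So the
  least upper bound of \<open>0\<close> and the lower bounds meets all of these conditions; the Slater point
  makes this supremum finite.
\<close>

lemma lagrange_multiplier_single:
  fixes F g :: "'a::real_vector \<Rightarrow> real"
  assumes F: "convex_on S F" and g: "convex_on S g"
    and slater: "y\<^sub>0 \<in> S" "g y\<^sub>0 < 0"
    and bound: "\<And>y. y \<in> S \<Longrightarrow> g y \<le> 0 \<Longrightarrow> p \<le> F y"
  shows "\<exists>l\<ge>0. \<forall>y\<in>S. p \<le> F y + l * g y"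
proof -
  define A where "A = insert 0 ((\<lambda>y. (p - F y) / g y) ` {y \<in> S. 0 < g y})"
  have upper: "a \<le> (F z - p) / (- g z)" if "a \<in> A" "z \<in> S" "g z < 0" for a z
  proof (cases "a = 0")
    case True
    with bound[of z] that show ?thesis by (simp add: divide_le_0_iff)
  next
    case False
    with that convex_crossing_bound[OF F g bound] show ?thesis
      unfolding A_def by blast
  qed
  have bdd: "bdd_above A"
    using upper slater by (intro bdd_aboveI) blast
  show ?thesis
  proof (intro exI[of _ "Sup A"] conjI ballI)
    show "0 \<le> Sup A"
      using bdd by (intro cSup_upper) (auto simp: A_def)
    fix y assume y: "y \<in> S"
    consider "g y < 0" | "g y = 0" | "0 < g y" by linarith
    then show "p \<le> F y + Sup A * g y"
    proof cases
      case 1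
      have "Sup A \<le> (F y - p) / (- g y)"
        using upper y 1 by (intro cSup_least) (auto simp: A_def)
      then have "Sup A * (- g y) \<le> F y - p"
        using 1 by (subst (asm) pos_le_divide_eq) auto
      then show ?thesis by simp
    next
      case 2
      then show ?thesis using bound y by simp
    next
      case 3
      have "(p - F y) / g y \<le> Sup A"
        using bdd y 3 by (intro cSup_upper) (auto simp: A_def)
      then have "p - F y \<le> Sup A * g y"
        using 3 by (simp add: pos_divide_le_eq)
      then show ?thesis by simp
    qed
  qed
qed

lemma convex_on_nonneg_combination:
  fixes g :: "'i \<Rightarrow> 'a::real_vector \<Rightarrow> real"
  assumes "finite I" and "convex S"
    and "\<And>i. i \<in> I \<Longrightarrow> convex_on S (g i)" and "\<And>i. i \<in> I \<Longrightarrow> 0 \<le> l i"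
  shows "convex_on S (\<lambda>y. \<Sum>i\<in>I. l i * g i y)"
  using assms
proof (induction I rule: finite_induct)
  case empty
  then show ?case by (simp add: convex_on_def)
next
  case (insert i I)
  then have "convex_on S (\<lambda>y. l i * g i y + (\<Sum>i\<in>I. l i * g i y))"
    by (intro convex_on_add convex_on_cmul) simp_all
  then show ?case using insert.hyps by simp
qed

text \<open>
  The domain \<open>S\<close> varies in the induction: the constraint to be removed last is first put into the
  domain, where the induction hypothesis supplies the other multipliers, and the resulting
  Lagrangian is then the convex objective of a problem with that one constraint.
\<close>

lemma lagrange_multipliers_finite:
  fixes f :: "'a::real_vector \<Rightarrow> real" and g :: "'i \<Rightarrow> 'a \<Rightarrow> real"
  assumes "finite I"
    and "convex_on S f" and "\<And>i. i \<in> I \<Longrightarrow> convex_on S (g i)"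
    and "y\<^sub>0 \<in> S" and "\<And>i. i \<in> I \<Longrightarrow> g i y\<^sub>0 < 0"
    and "\<And>y. y \<in> S \<Longrightarrow> (\<And>i. i \<in> I \<Longrightarrow> g i y \<le> 0) \<Longrightarrow> p \<le> f y"
  shows "\<exists>l. (\<forall>i\<in>I. 0 \<le> l i) \<and> (\<forall>y\<in>S. p \<le> f y + (\<Sum>i\<in>I. l i * g i y))"
  using assms
proof (induction I arbitrary: S rule: finite_induct)
  case empty
  then show ?case by simp
next
  case (insert j I)
  define T where "T = {y \<in> S. g j y \<le> 0}"
  have gj: "convex_on S (g j)" using insert.prems by blast
  have T: "convex T"
  proof (rule convexI)
    fix x y and u v :: real
    assume *: "x \<in> T" "y \<in> T" "0 \<le> u" "0 \<le> v" "u + v = 1"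
    have "g j (u *\<^sub>R x + v *\<^sub>R y) \<le> u * g j x + v * g j y"
      using gj * by (simp add: convex_on_def T_def)
    also have "\<dots> \<le> 0"
      using * by (simp add: T_def add_nonpos_nonpos mult_nonneg_nonpos)
    finally show "u *\<^sub>R x + v *\<^sub>R y \<in> T"
      using gj * by (simp add: convex_on_def convex_def T_def)
  qed
  have restrict: "convex_on T h" if "convex_on S h" for h :: "'a \<Rightarrow> real"
    using that T by (auto simp: convex_on_def T_def)
  have "\<exists>l. (\<forall>i\<in>I. 0 \<le> l i) \<and> (\<forall>y\<in>T. p \<le> f y + (\<Sum>i\<in>I. l i * g i y))"
  proof (rule insert.IH)
    show "convex_on T f" "\<And>i. i \<in> I \<Longrightarrow> convex_on T (g i)"
      using insert.prems restrict by auto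
    show "y\<^sub>0 \<in> T" "\<And>i. i \<in> I \<Longrightarrow> g i y\<^sub>0 < 0"
      using insert.prems by (auto simp: T_def less_imp_le)
    show "p \<le> f y" if "y \<in> T" "\<And>i. i \<in> I \<Longrightarrow> g i y \<le> 0" for y
      using that insert.prems(5)[of y] by (auto simp: T_def)
  qed
  then obtain l where l: "\<forall>i\<in>I. 0 \<le> l i"
    and lT: "\<forall>y\<in>T. p \<le> f y + (\<Sum>i\<in>I. l i * g i y)" by blast
  have "convex_on S (\<lambda>y. \<Sum>i\<in>I. l i * g i y)"
    using insert.hyps insert.prems(2) l convex_on_imp_convex[OF gj]
    by (intro convex_on_nonneg_combination) auto
  then have "convex_on S (\<lambda>y. f y + (\<Sum>i\<in>I. l i * g i y))"
    using insert.prems(1) by (intro convex_on_add)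
  then have "\<exists>c\<ge>0. \<forall>y\<in>S. p \<le> f y + (\<Sum>i\<in>I. l i * g i y) + c * g j y"
  proof (rule lagrange_multiplier_single)
    show "convex_on S (g j)" by (fact gj)
    show "y\<^sub>0 \<in> S" by (fact insert.prems(3))
    show "g j y\<^sub>0 < 0" using insert.prems(4) by simp
    show "p \<le> f y + (\<Sum>i\<in>I. l i * g i y)" if "y \<in> S" "g j y \<le> 0" for y
      using lT that by (simp add: T_def)
  qed
  then obtain c where c: "c \<ge> 0"
    "\<forall>y\<in>S. p \<le> f y + (\<Sum>i\<in>I. l i * g i y) + c * g j y" by blast
  have "(\<Sum>i\<in>insert j I. (l(j := c)) i * g i y) = (\<Sum>i\<in>I. l i * g i y) + c * g j y" for y
  proof -
    have "(\<Sum>i\<in>I. (l(j := c)) i * g i y) = (\<Sum>i\<in>I. l i * g i y)"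
      using insert.hyps by (intro sum.cong) auto
    then show ?thesis using insert.hyps by simp
  qed
  then show ?case
    using c l by (intro exI[of _ "l(j := c)"]) (simp add: add.assoc)
qed

theorem corollary8p3:
  fixes f :: "'a::lctv_space \<Rightarrow> real"
    and g :: "nat \<Rightarrow> 'a \<Rightarrow> real"
    and m :: nat
  assumes "convex_on UNIV f" and "continuous_on UNIV f"
    and "\<And>i. i \<in> {1..m} \<Longrightarrow> convex_on UNIV (g i)"
    and "\<And>i. i \<in> {1..m} \<Longrightarrow> continuous_on UNIV (g i)"
    and slater: "\<exists>y\<^sub>0. \<forall>i\<in>{1..m}. g i y\<^sub>0 < 0"
  shows "(INF y\<in>{y. \<forall>i\<in>{1..m}. g i y \<le> 0}. ereal (f y))
       = (SUP l\<in>{l \<in> {1..m} \<rightarrow>\<^sub>E UNIV. \<forall>i\<in>{1..m}. 0 \<le> l i}. lagrange_dual m f g l)"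
    (is "?P = ?D")
proof (rule antisym)
  obtain y\<^sub>0 where y\<^sub>0: "\<And>i. i \<in> {1..m} \<Longrightarrow> g i y\<^sub>0 < 0"
    using slater by blast
  show "?P \<le> ?D"
  proof (cases ?P)
    case (real p)
    have "p \<le> f y" if "\<And>i. i \<in> {1..m} \<Longrightarrow> g i y \<le> 0" for y
    proof -
      have "?P \<le> ereal (f y)" using that by (intro INF_lower) simp
      then show ?thesis using real by simp
    qed
    then have "\<exists>l. (\<forall>i\<in>{1..m}. 0 \<le> l i) \<and>
        (\<forall>y\<in>UNIV. p \<le> f y + (\<Sum>i\<in>{1..m}. l i * g i y))"
      using assms y\<^sub>0 by (intro lagrange_multipliers_finite[of "{1..m}" UNIV f g y\<^sub>0 p]) auto
    then obtain l where l: "\<forall>i\<in>{1..m}. 0 \<le> l i"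
      "\<And>y. p \<le> f y + (\<Sum>i=1..m. l i * g i y)" by blast
    have "ereal p \<le> lagrange_dual m f g (restrict l {1..m})"
      unfolding lagrange_dual_def using l(2) by (intro INF_greatest) simp
    also have "\<dots> \<le> ?D"
      using l(1) by (intro SUP_upper) (simp add: PiE_def extensional_def)
    finally show ?thesis using real by simp
  next
    case PInf
    have "?P \<le> ereal (f y\<^sub>0)"
      using y\<^sub>0 by (intro INF_lower) (simp add: less_imp_le)
    with PInf show ?thesis by simp
  next
    case MInf
    then show ?thesis by simp
  qed
  show "?D \<le> ?P"
  proof (intro SUP_least INF_greatest)
    fix l :: "nat \<Rightarrow> real" and y
    assume l: "l \<in> {l \<in> {1..m} \<rightarrow>\<^sub>E UNIV. \<forall>i\<in>{1..m}. 0 \<le> l i}"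
      and y: "y \<in> {y. \<forall>i\<in>{1..m}. g i y \<le> 0}"
    have "lagrange_dual m f g l \<le> ereal (f y + (\<Sum>i=1..m. l i * g i y))"
      unfolding lagrange_dual_def by (intro INF_lower) simp
    also have "(\<Sum>i=1..m. l i * g i y) \<le> 0"
      using l y by (intro sum_nonpos mult_nonneg_nonpos) auto
    then have "ereal (f y + (\<Sum>i=1..m. l i * g i y)) \<le> ereal (f y)" by simp
    finally show "lagrange_dual m f g l \<le> ereal (f y)" .
  qed
qed

end
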